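(* Let $(Y_t)$ be a sequence of positive random variables and $(Z_t)$ a sequence of non-negative random variables, both adapted to a filtration $(\mathcal F_t)$, and let $c_1,c_2>0$ be constants. Let $\gamma\in(0,1]$, $p\in(\frac1{1+\gamma},1)$, and let $\alpha_t>0$ be deterministic with $\alpha_t=\Theta(t^{-p})$. Suppose that 1. for every fixed $s>0$, $\mathbb E[Y_{t+1}\mid\mathcal F_s]\le\mathbb E[Y_t\mid\mathcal F_s](1+c_1\alpha_t^{1+\gamma})+\alpha_t^{1+\gamma}\big(\mathbb E[Z_t\mid\mathcal F_s]+c_2\big)$ for all $t\ge s$; 2. $\sum_{t=1}^\infty\alpha_t\,\mathbb E[Y_t]<\infty$ and $\sum_{t=1}^\infty\alpha_t\,\mathbb E[Z_t]<\infty$. Then for every $\epsilon>0$, almost surely, $\lim_{t\to\infty}t^{\min(1-p,\;p(1+\gamma)-1)-\epsilon}\,Y_t=0$.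
   Context: Time $t$ ranges over the non-negative integers. $\alpha_t=\Theta(t^{-p})$ means there are $c,c'>0$ with $c\,t^{-p}\le\alpha_t\le c'\,t^{-p}$ for all large $t$. *)

theory Defs
  imports
    "HOL-Probability.Probability"
    "HOL-Library.Landau_Symbols"
begin

end

theory Submission
  imports Defs
begin

text \<open>
  Let \<open>\<delta> = min (1 - p) (p * (1 + \<gamma>) - 1)\<close> and pick a positive \<open>\<beta>\<close> with \<open>\<delta> - \<epsilon> < \<beta> < \<delta>\<close>.
  The choice \<open>\<beta> \<le> 1 - p\<close> makes the increment of \<open>t powr \<beta>\<close> of order at most \<open>\<alpha> t\<close>, and
  \<open>\<beta> < p * (1 + \<gamma>) - 1\<close> makes \<open>t powr \<beta> * \<alpha> t powr (1 + \<gamma>)\<close> both \<open>O(\<alpha> t)\<close> and summable. Hence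
  \<open>W t = t powr \<beta> * Y t\<close> is a supermartingale up to drifts whose expectations are summable. A
  Doob-type maximal inequality shows that \<open>W\<close> is almost surely bounded, so
  \<open>t powr (\<delta> - \<epsilon>) * Y t\<close> is at most a constant times \<open>t powr (\<delta> - \<epsilon> - \<beta>)\<close>, which tends to 0;
  convergence of \<open>W\<close> is not needed.
\<close>

lemma AE_bounded_almost_supermartingale:
  fixes W :: "nat \<Rightarrow> 'a \<Rightarrow> ennreal" and r :: "nat \<Rightarrow> ennreal"
  assumes filt: "filtration (space M) F"
    and sub: "\<And>t. subalgebra M (F t)"
    and W: "\<And>t. W t \<in> borel_measurable (F t)"
    and step: "\<And>t A. A \<in> sets (F t) \<Longrightarrow>
      (\<integral>\<^sup>+\<omega>\<in>A. W (Suc t) \<omega> \<partial>M) \<le> (\<integral>\<^sup>+\<omega>\<in>A. W t \<omega> \<partial>M) + r t"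
    and W0: "(\<integral>\<^sup>+\<omega>. W 0 \<omega> \<partial>M) < \<infinity>"
    and r: "(\<Sum>t. r t) < \<infinity>"
  shows "AE \<omega> in M. \<exists>n::nat. \<forall>t. W t \<omega> < of_nat n"
proof -
  define C where "C = (\<integral>\<^sup>+\<omega>. W 0 \<omega> \<partial>M) + (\<Sum>t. r t)"
  have C: "C < \<infinity>" using W0 r by (simp add: C_def)
  define B where "B = (\<lambda>(n::nat) t. {\<omega> \<in> space M. \<forall>s\<le>t. W s \<omega> < of_nat n})"
  have spF: "space (F t) = space M" for t
    using sub by (simp add: subalgebra_def)
  have WF: "W s \<in> borel_measurable (F t)" if "s \<le> t" for s t
    using W[of s] filtration.sets_F_mono[OF filt that] spF
    by (auto simp: measurable_def)
  have WM[measurable]: "W t \<in> borel_measurable M" for t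
    using measurable_from_subalg[OF sub W] .
  have BF: "B n t \<in> sets (F t)" for n t
  proof -
    have "{\<omega> \<in> space (F t). \<forall>s\<in>{..t}. W s \<omega> < of_nat n} \<in> sets (F t)"
      using WF by (intro sets.sets_Collect_finite_All' borel_measurable_less) auto
    also have "{\<omega> \<in> space (F t). \<forall>s\<in>{..t}. W s \<omega> < of_nat n} = B n t"
      by (auto simp: B_def spF)
    finally show ?thesis .
  qed
  have BM[measurable]: "B n t \<in> sets M" for n t
    using BF[of n t] sub[of t] by (auto simp: subalgebra_def)
  \<comment> \<open>\<open>u n t\<close> is the expectation of \<open>W\<close> replaced by the constant \<open>n\<close> from its first passage to \<open>n\<close> on.\<close>
  define u where "u = (\<lambda>n t. \<integral>\<^sup>+\<omega>. W t \<omega> * indicator (B n t) \<omega>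
      + of_nat n * indicator (space M - B n t) \<omega> \<partial>M)"
  have u: "u n t \<le> (\<integral>\<^sup>+\<omega>. W 0 \<omega> \<partial>M) + (\<Sum>s<t. r s)" for n t
  proof (induction t)
    case 0
    show ?case unfolding u_def
      by (auto intro!: nn_integral_mono simp: B_def indicator_def not_less)
  next
    case (Suc t)
    \<comment> \<open>The two integrands differ only where the first passage happens at time
      \<open>Suc t\<close>; there \<open>W (Suc t)\<close> is at least \<open>n\<close>, so putting
      it in place of \<open>n\<close> can only enlarge the integral.\<close>
    have "u n (Suc t) \<le> (\<integral>\<^sup>+\<omega>. W (Suc t) \<omega> * indicator (B n t) \<omega>
      + of_nat n * indicator (space M - B n t) \<omega> \<partial>M)"
      unfolding u_def
      by (rule nn_integral_mono) (auto simp: B_def indicator_def not_less le_Suc_eq)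
    also have "\<dots> = (\<integral>\<^sup>+\<omega>\<in>B n t. W (Suc t) \<omega> \<partial>M)
        + (\<integral>\<^sup>+\<omega>. of_nat n * indicator (space M - B n t) \<omega> \<partial>M)"
      by (rule nn_integral_add) measurable
    also have "\<dots> \<le> ((\<integral>\<^sup>+\<omega>\<in>B n t. W t \<omega> \<partial>M) + r t)
        + (\<integral>\<^sup>+\<omega>. of_nat n * indicator (space M - B n t) \<omega> \<partial>M)"
      by (intro add_right_mono step BF)
    also have "\<dots> = u n t + r t"
      unfolding u_def by (subst nn_integral_add) (auto simp: ac_simps)
    also have "\<dots> \<le> (\<integral>\<^sup>+\<omega>. W 0 \<omega> \<partial>M) + (\<Sum>s<Suc t. r s)"
      using add_right_mono[OF Suc.IH, of "r t"] by (simp add: ac_simps)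
    finally show ?case .
  qed
  have exceed: "of_nat n * emeasure M (space M - B n t) \<le> C" for n t
  proof -
    have "of_nat n * emeasure M (space M - B n t)
        = (\<integral>\<^sup>+\<omega>. of_nat n * indicator (space M - B n t) \<omega> \<partial>M)"
      by (simp add: nn_integral_cmult_indicator)
    also have "\<dots> \<le> u n t"
      unfolding u_def by (intro nn_integral_mono) auto
    also have "\<dots> \<le> C"
      using u[of n t] unfolding C_def
      by (rule order_trans) (intro add_left_mono sum_le_suminf, auto)
    finally show ?thesis .
  qed
  \<comment> \<open>\<open>D n\<close> is the event that level \<open>n\<close> is ever reached. It
    is an increasing union over \<open>t\<close>, so the bound survives the limit by continuity from
    below.\<close>
  define D where "D = (\<lambda>n. \<Union>t. space M - B n t)"
  have D_le: "of_nat n * emeasure M (D n) \<le> C" for n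
  proof -
    have "emeasure M (D n) = (SUP t. emeasure M (space M - B n t))"
      unfolding D_def
      by (intro SUP_emeasure_incseq[symmetric]) (auto simp: incseq_def B_def intro: order_trans)
    then show ?thesis
      by (simp add: SUP_mult_left_ennreal SUP_le_iff exceed)
  qed
  have DM[measurable]: "D n \<in> sets M" for n
    unfolding D_def by measurable
  \<comment> \<open>On \<open>E\<close> every level is reached. Its measure times any
    \<open>n\<close> is at most the finite \<open>C\<close>, which forces it to vanish.\<close>
  define E where "E = (\<Inter>n. D n)"
  have EM: "E \<in> sets M" unfolding E_def by measurable
  have E_le: "of_nat n * emeasure M E \<le> C" for n
    using D_le[of n] by (rule order_trans[rotated])
      (auto intro!: mult_left_mono emeasure_mono simp: E_def)
  have "emeasure M E = 0"
  proof (rule ccontr)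
    assume "emeasure M E \<noteq> 0"
    then have "(SUP n. of_nat n * emeasure M E) = \<top>"
      by (simp add: SUP_mult_right_ennreal[symmetric] ennreal_SUP_of_nat_eq_top ennreal_top_mult)
    moreover have "(SUP n. of_nat n * emeasure M E) \<le> C"
      by (intro SUP_least E_le)
    ultimately have "\<top> \<le> C" by (rule ord_eq_le_trans[OF sym])
    then show False using C by (simp add: top_unique)
  qed
  then have "AE \<omega> in M. \<omega> \<notin> E"
    using EM by (intro AE_not_in) (auto simp: null_sets_def)
  then show ?thesis
    by (rule AE_mp) (rule AE_I2, auto simp: E_def D_def B_def)
qed

text \<open>Factor out \<open>t powr \<beta>\<close>; the remaining base \<open>1 + 1 / t\<close> is
  at least 1, so raising its exponent from \<beta> to 1 only increases it.\<close>

lemma powr_Suc_le: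
  fixes \<beta> :: real
  assumes "0 < t" "0 \<le> \<beta>" "\<beta> \<le> 1"
  shows "real (Suc t) powr \<beta> \<le> real t powr \<beta> + real t powr (\<beta> - 1)"
proof -
  have t: "real t > 0" using assms by simp
  have "real (Suc t) powr \<beta> = real t powr \<beta> * (1 + 1 / real t) powr \<beta>"
    using t by (subst powr_mult[symmetric]) (auto simp: distrib_left ac_simps)
  also have "\<dots> \<le> real t powr \<beta> * (1 + 1 / real t) powr 1"
    using assms t by (intro mult_left_mono powr_mono) auto
  also have "\<dots> = real t powr \<beta> + real t powr (\<beta> - 1)"
    using t by (simp add: field_simps powr_diff)
  finally show ?thesis by simp
qed

text \<open>After multiplying the recursion by the weight at time \<open>Suc t\<close>, these bounds
  control the coefficients of \<open>Y t\<close>, of \<open>Z t\<close> and of \<open>c2\<close> in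
  turn. Both exponents that occur, \<open>\<beta> - 1\<close> and \<open>\<beta> - p * q\<close>,
  are at most \<open>- p\<close>, so these powers are dominated by \<alpha>. The third bound keeps a
  pure power, because \<open>c2\<close> must be paired with a summable sequence.\<close>

lemma step_size_coefficient_bounds:
  fixes \<alpha> :: "nat \<Rightarrow> real" and \<beta> c1 p q :: real
  assumes \<alpha>: "\<And>t. 0 < \<alpha> t" "\<alpha> \<in> \<Theta>(\<lambda>t. real t powr (- p))"
    and c1: "0 \<le> c1" and p: "0 \<le> p" "p \<le> 1" and q: "0 \<le> q"
    and \<beta>: "0 \<le> \<beta>" "\<beta> \<le> 1 - p" "\<beta> \<le> p * q - 1"
  obtains K where "0 < K"
    "\<forall>\<^sub>F t in sequentially.
      real (Suc t) powr \<beta> * (1 + c1 * \<alpha> t powr q) \<le> real t powr \<beta> + K * \<alpha> t \<and>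
      real (Suc t) powr \<beta> * \<alpha> t powr q \<le> K * \<alpha> t \<and>
      real (Suc t) powr \<beta> * \<alpha> t powr q \<le> K * real t powr (\<beta> - p * q)"
proof -
  obtain a where a: "0 < a" "\<forall>\<^sub>F t in sequentially. norm (\<alpha> t) \<le> a * norm (real t powr (- p))"
    using landau_o.bigE[OF bigthetaD1[OF \<alpha>(2)]] by blast
  have "(\<lambda>t. real t powr (- p)) \<in> O(\<alpha>)"
    using bigthetaD2[OF \<alpha>(2)] by (simp add: bigomega_iff_bigo)
  then obtain b where b: "0 < b" "\<forall>\<^sub>F t in sequentially. norm (real t powr (- p)) \<le> b * norm (\<alpha> t)"
    using landau_o.bigE by blast
  \<comment> \<open>In \<open>L\<close>, the 2 comes from replacing \<open>Suc t\<close> by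
    \<open>t\<close> in the weight and \<open>a powr q\<close> from the upper bound on \<alpha>. In
    \<open>K\<close>, the summand \<open>L\<close> serves the third bound, \<open>b\<close> the
    growth of the weight, \<open>L * c1 * b\<close> the factor
    \<open>1 + c1 * \<alpha> t powr q\<close>, and \<open>L * b\<close> the second bound.\<close>
  define L where "L = 2 * a powr q"
  define K where "K = L + (1 + L * c1 + L) * b"
  have L: "0 < L" using a by (simp add: L_def)
  have K: "0 < K" unfolding K_def using L b c1 by (auto intro!: add_pos_nonneg mult_nonneg_nonneg)
  have "\<forall>\<^sub>F t in sequentially.
      real (Suc t) powr \<beta> * (1 + c1 * \<alpha> t powr q) \<le> real t powr \<beta> + K * \<alpha> t \<and>
      real (Suc t) powr \<beta> * \<alpha> t powr q \<le> K * \<alpha> t \<and>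
      real (Suc t) powr \<beta> * \<alpha> t powr q \<le> K * real t powr (\<beta> - p * q)"
    using a(2) b(2) eventually_gt_at_top[of 0]
  proof eventually_elim
    case (elim t)
    have t: "real t \<ge> 1" using elim by simp
    have le1: "real (Suc t) powr \<beta> \<le> real t powr \<beta> + real t powr (\<beta> - 1)"
      using elim \<beta> p by (intro powr_Suc_le) auto
    have "real t powr (\<beta> - 1) \<le> real t powr \<beta>"
      using t by (intro powr_mono) auto
    with le1 have le2: "real (Suc t) powr \<beta> \<le> 2 * real t powr \<beta>" by simp
    have le3: "real t powr (\<beta> - 1) \<le> real t powr (- p)"
      using t \<beta> by (intro powr_mono) auto
    have le4: "real t powr (\<beta> - p * q) \<le> real t powr (- p)"
      using t \<beta> p by (intro powr_mono) auto
    have le5: "real t powr (- p) \<le> b * \<alpha> t"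
      using elim \<alpha>(1)[of t] by simp
    have "\<alpha> t powr q \<le> (a * real t powr (- p)) powr q"
      using elim \<alpha>(1)[of t] q by (intro powr_mono2) auto
    also have "\<dots> = a powr q * real t powr (- (p * q))"
      using a by (simp add: powr_mult powr_powr)
    finally have "real (Suc t) powr \<beta> * \<alpha> t powr q
        \<le> (2 * real t powr \<beta>) * (a powr q * real t powr (- (p * q)))"
      using le2 by (intro mult_mono) auto
    also have "\<dots> = L * real t powr (\<beta> - p * q)"
      by (simp add: L_def powr_add[symmetric])
    finally have le6: "real (Suc t) powr \<beta> * \<alpha> t powr q \<le> L * real t powr (\<beta> - p * q)" .
    also have "\<dots> \<le> L * (b * \<alpha> t)"
      using le4 le5 L by (intro mult_left_mono) auto
    finally have le7: "real (Suc t) powr \<beta> * \<alpha> t powr q \<le> L * (b * \<alpha> t)" .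
    have b\<alpha>: "0 < b * \<alpha> t" using b \<alpha>(1) by simp
    have nn: "0 \<le> L * c1 * (b * \<alpha> t)" "0 \<le> L * (b * \<alpha> t)" "0 \<le> L * \<alpha> t"
      using L c1 b\<alpha> \<alpha>(1)[of t] by auto
    have K\<alpha>: "K * \<alpha> t = L * \<alpha> t + b * \<alpha> t + L * c1 * (b * \<alpha> t) + L * (b * \<alpha> t)"
      by (simp add: K_def algebra_simps)
    have "c1 * (real (Suc t) powr \<beta> * \<alpha> t powr q) \<le> c1 * (L * (b * \<alpha> t))"
      using le7 c1 by (rule mult_left_mono)
    then have "real (Suc t) powr \<beta> * (1 + c1 * \<alpha> t powr q) \<le> real t powr \<beta> + K * \<alpha> t"
      using le1 le3 le5 nn K\<alpha> by (simp add: algebra_simps)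
    moreover have "L \<le> K" using L b c1 by (auto simp: K_def)
    then have "L * real t powr (\<beta> - p * q) \<le> K * real t powr (\<beta> - p * q)"
      by (intro mult_right_mono) auto
    ultimately show ?case using le6 le7 nn K\<alpha> b\<alpha> by linarith
  qed
  with K show ?thesis by (rule that)
qed

text \<open>Integrate the conditional inequality over \<open>A\<close>; since \<open>A\<close> is in
  \<open>G\<close>, the defining property of conditional expectation replaces each conditional
  expectation by the function itself.\<close>

lemma nn_set_integral_recursion:
  fixes f g h :: "'a \<Rightarrow> ennreal" and a c k :: ennreal
  assumes sf: "sigma_finite_subalgebra M G"
    and [measurable]: "f \<in> borel_measurable M" "g \<in> borel_measurable M" "h \<in> borel_measurable M"
    and le: "AE \<omega> in M. nn_cond_exp M G f \<omega>
      \<le> nn_cond_exp M G g \<omega> * k + a * (nn_cond_exp M G h \<omega> + c)"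
    and A: "A \<in> sets G"
  shows "(\<integral>\<^sup>+\<omega>\<in>A. f \<omega> \<partial>M) \<le> k * (\<integral>\<^sup>+\<omega>\<in>A. g \<omega> \<partial>M)
    + a * (\<integral>\<^sup>+\<omega>\<in>A. h \<omega> \<partial>M) + a * c * emeasure M A"
proof -
  interpret sigma_finite_subalgebra M G by fact
  have AM[measurable]: "A \<in> sets M" using A subalg by (auto simp: subalgebra_def)
  have cond: "(\<integral>\<^sup>+\<omega>. indicator A \<omega> * nn_cond_exp M G v \<omega> \<partial>M) = (\<integral>\<^sup>+\<omega>\<in>A. v \<omega> \<partial>M)"
    if "v \<in> borel_measurable M" for v
    using A that by (subst nn_cond_exp_intg) (auto simp: ac_simps)
  have "(\<integral>\<^sup>+\<omega>\<in>A. f \<omega> \<partial>M) = (\<integral>\<^sup>+\<omega>. indicator A \<omega> * nn_cond_exp M G f \<omega> \<partial>M)"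
    by (simp add: cond)
  also have "\<dots> \<le> (\<integral>\<^sup>+\<omega>. k * (indicator A \<omega> * nn_cond_exp M G g \<omega>)
      + a * (indicator A \<omega> * nn_cond_exp M G h \<omega>) + a * c * indicator A \<omega> \<partial>M)"
    using le by (intro nn_integral_mono_AE, elim AE_mp)
      (intro AE_I2, auto simp: indicator_def ac_simps distrib_left)
  also have "\<dots> = k * (\<integral>\<^sup>+\<omega>\<in>A. g \<omega> \<partial>M)
    + a * (\<integral>\<^sup>+\<omega>\<in>A. h \<omega> \<partial>M) + a * c * emeasure M A"
    by (simp add: nn_integral_add nn_integral_cmult cond nn_integral_cmult_indicator)
  finally show ?thesis .
qed

lemma suminf_ennreal_shift_le:
  fixes f :: "nat \<Rightarrow> ennreal"
  shows "(\<Sum>n. f (n + k)) \<le> (\<Sum>n. f n)"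
proof (rule suminf_le_const)
  fix n
  have "(\<Sum>i<n. f (i + k)) = sum f ((\<lambda>i. i + k) ` {..<n})"
    by (subst sum.reindex) auto
  also have "\<dots> \<le> (\<Sum>n. f n)"
    by (rule sum_le_suminf) auto
  finally show "(\<Sum>i<n. f (i + k)) \<le> (\<Sum>n. f n)" .
qed auto

theorem lemma2p5:
  fixes M :: "'a measure"
    and F :: "nat \<Rightarrow> 'a measure"
    and Y Z :: "nat \<Rightarrow> 'a \<Rightarrow> real"
    and \<alpha> :: "nat \<Rightarrow> real"
    and c1 c2 \<gamma> p :: real
  assumes "prob_space M"
    and "filtration (space M) F"
    and "\<And>t. subalgebra M (F t)"
    and "\<And>t. Y t \<in> borel_measurable (F t)"
    and "\<And>t. Z t \<in> borel_measurable (F t)"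
    and "\<And>t \<omega>. \<omega> \<in> space M \<Longrightarrow> 0 < Y t \<omega>"
    and "\<And>t \<omega>. \<omega> \<in> space M \<Longrightarrow> 0 \<le> Z t \<omega>"
    and "0 < c1" and "0 < c2"
    and "0 < \<gamma>" and "\<gamma> \<le> 1"
    and "1 / (1 + \<gamma>) < p" and "p < 1"
    and "\<And>t. 0 < \<alpha> t"
    and "\<alpha> \<in> \<Theta>(\<lambda>t. real t powr (- p))"
    and "\<And>s t. 0 < s \<Longrightarrow> s \<le> t \<Longrightarrow>
      AE \<omega> in M.
        nn_cond_exp M (F s) (\<lambda>\<omega>'. ennreal (Y (Suc t) \<omega>')) \<omega>
        \<le> nn_cond_exp M (F s) (\<lambda>\<omega>'. ennreal (Y t \<omega>')) \<omega>
              * ennreal (1 + c1 * \<alpha> t powr (1 + \<gamma>))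
            + ennreal (\<alpha> t powr (1 + \<gamma>))
              * (nn_cond_exp M (F s) (\<lambda>\<omega>'. ennreal (Z t \<omega>')) \<omega> + ennreal c2)"
    and "(\<Sum>t. ennreal (\<alpha> (Suc t)) * (\<integral>\<^sup>+ \<omega>. ennreal (Y (Suc t) \<omega>) \<partial>M)) < \<infinity>"
    and "(\<Sum>t. ennreal (\<alpha> (Suc t)) * (\<integral>\<^sup>+ \<omega>. ennreal (Z (Suc t) \<omega>) \<partial>M)) < \<infinity>"
  shows "\<forall>\<epsilon>>0. AE \<omega> in M.
    (\<lambda>t. real t powr (min (1 - p) (p * (1 + \<gamma>) - 1) - \<epsilon>) * Y t \<omega>) \<longlonglongrightarrow> 0"
proof (intro allI impI)
  fix \<epsilon> :: real
  assume \<epsilon>: "0 < \<epsilon>"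
  note filt = assms(2) and sub = assms(3) and YF = assms(4) and ZF = assms(5)
  note Ypos = assms(6) and Znn = assms(7) and \<alpha> = assms(14)
  interpret prob_space M by fact
  have sfin: "sigma_finite_subalgebra M (F t)" for t
    by (intro finite_measure_subalgebra_is_sigma_finite finite_measure_subalgebra.intro
        finite_measure_subalgebra_axioms.intro finite_measure_axioms sub)
  have [measurable]: "Y t \<in> borel_measurable M" "Z t \<in> borel_measurable M" for t
    using measurable_from_subalg[OF sub] YF ZF by blast+
  define q where "q = 1 + \<gamma>"
  define \<delta> where "\<delta> = min (1 - p) (p * q - 1)"
  have p0: "0 < p" using assms(10,12) by (smt (verit) divide_pos_pos)
  \<comment> \<open>Both entries of the minimum are positive: \<open>p < 1\<close>, and
    \<open>1 / (1 + \<gamma>) < p\<close> says \<open>1 < p * q\<close>.\<close>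
  have "0 < \<delta>" using assms(10,12,13) by (auto simp: \<delta>_def q_def field_simps)
  obtain \<beta> where \<beta>: "0 < \<beta>" "\<delta> - \<epsilon> < \<beta>" "\<beta> < \<delta>"
    using \<open>0 < \<delta>\<close> \<epsilon> dense[of "max 0 (\<delta> - \<epsilon>)" \<delta>] by auto
  obtain K where K: "0 < K" and ev: "\<forall>\<^sub>F t in sequentially.
      real (Suc t) powr \<beta> * (1 + c1 * \<alpha> t powr q) \<le> real t powr \<beta> + K * \<alpha> t \<and>
      real (Suc t) powr \<beta> * \<alpha> t powr q \<le> K * \<alpha> t \<and>
      real (Suc t) powr \<beta> * \<alpha> t powr q \<le> K * real t powr (\<beta> - p * q)"
    using step_size_coefficient_bounds[OF \<alpha> assms(15), of c1 q \<beta>] assms(8,10,13) p0 \<beta>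
    by (auto simp: \<delta>_def q_def)
  obtain m where m: "\<And>t. m \<le> t \<Longrightarrow>
      real (Suc t) powr \<beta> * (1 + c1 * \<alpha> t powr q) \<le> real t powr \<beta> + K * \<alpha> t \<and>
      real (Suc t) powr \<beta> * \<alpha> t powr q \<le> K * \<alpha> t \<and>
      real (Suc t) powr \<beta> * \<alpha> t powr q \<le> K * real t powr (\<beta> - p * q)"
    using ev unfolding eventually_sequentially by blast
  \<comment> \<open>The successor makes \<open>N\<close> positive: the recursion is assumed only for
    \<open>0 < s\<close>, and the assumed series start at index 1, so shifting them by
    \<open>m\<close> gives the indices \<open>t + N\<close>.\<close>
  define N where "N = Suc m"
  define W where "W = (\<lambda>t \<omega>. ennreal (real t powr \<beta>) * ennreal (Y t \<omega>))"
  define y where "y = (\<lambda>t. \<integral>\<^sup>+\<omega>. ennreal (Y t \<omega>) \<partial>M)"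
  define z where "z = (\<lambda>t. \<integral>\<^sup>+\<omega>. ennreal (Z t \<omega>) \<partial>M)"
  \<comment> \<open>The three drifts come from \<open>Y\<close>, \<open>Z\<close> and
    \<open>c2\<close>. Expectations over the whole space make \<open>r t\<close> the same for every
    event \<open>A\<close>.\<close>
  define r where "r = (\<lambda>t. ennreal K * (ennreal (\<alpha> t) * y t) + ennreal K * (ennreal (\<alpha> t) * z t)
      + ennreal (K * c2) * ennreal (real t powr (\<beta> - p * q)))"
  have step: "(\<integral>\<^sup>+\<omega>\<in>A. W (Suc t) \<omega> \<partial>M) \<le> (\<integral>\<^sup>+\<omega>\<in>A. W t \<omega> \<partial>M) + r t"
    if t: "N \<le> t" and A: "A \<in> sets (F t)" for t A
  proof -
    have AM[measurable]: "A \<in> sets M" using A sub by (auto simp: subalgebra_def)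
    define w where "w = real (Suc t) powr \<beta>"
    define a where "a = \<alpha> t powr q"
    define IY where "IY = (\<integral>\<^sup>+\<omega>\<in>A. ennreal (Y t \<omega>) \<partial>M)"
    define IZ where "IZ = (\<integral>\<^sup>+\<omega>\<in>A. ennreal (Z t \<omega>) \<partial>M)"
    have nn: "0 \<le> w" "0 \<le> a" "0 \<le> 1 + c1 * a" "0 < \<alpha> t" "0 < c1" "0 < c2"
      using assms(8,9) \<alpha> by (auto simp: w_def a_def)
    have bounds: "w * (1 + c1 * a) \<le> real t powr \<beta> + K * \<alpha> t" "w * a \<le> K * \<alpha> t"
        "w * a \<le> K * real t powr (\<beta> - p * q)"
      using m[of t] t by (auto simp: N_def w_def a_def)
    have ebounds: "ennreal (w * (1 + c1 * a)) \<le> ennreal (real t powr \<beta> + K * \<alpha> t)"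
        "ennreal (w * a) \<le> ennreal (K * \<alpha> t)"
        "ennreal (w * a * c2) \<le> ennreal (K * real t powr (\<beta> - p * q) * c2)"
      using nn by (intro ennreal_leI bounds mult_right_mono[OF bounds(3)]; simp)+
    have IY: "IY \<le> y t" and IZ: "IZ \<le> z t"
      unfolding IY_def IZ_def y_def z_def by (intro nn_integral_mono; simp add: indicator_def)+
    have "(\<integral>\<^sup>+\<omega>\<in>A. W (Suc t) \<omega> \<partial>M) = ennreal w * (\<integral>\<^sup>+\<omega>\<in>A. ennreal (Y (Suc t) \<omega>) \<partial>M)"
      by (simp add: W_def w_def nn_integral_cmult mult.assoc)
    \<comment> \<open>The assumed recursion is used with \<open>s = t\<close>, which matches events
      \<open>A\<close> of \<open>F t\<close>.\<close>
    also have "\<dots> \<le> ennreal w * (ennreal (1 + c1 * a) * IY + ennreal a * IZ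
        + ennreal a * ennreal c2 * emeasure M A)"
      unfolding IY_def IZ_def a_def q_def using t assms(16)[of t t]
      by (intro mult_left_mono nn_set_integral_recursion[OF sfin _ _ _ _ A]) (auto simp: N_def)
    also have "\<dots> = ennreal (w * (1 + c1 * a)) * IY + ennreal (w * a) * IZ
        + ennreal (w * a * c2) * emeasure M A"
      unfolding ennreal_mult[OF nn(1,3)]
      using nn by (simp add: ennreal_mult distrib_left mult.assoc del: ennreal_plus)
    also have "\<dots> \<le> ennreal (real t powr \<beta> + K * \<alpha> t) * IY + ennreal (K * \<alpha> t) * IZ
        + ennreal (K * real t powr (\<beta> - p * q) * c2) * 1"
      by (intro add_mono mult_mono ebounds emeasure_le_1 order_refl) auto
    also have "\<dots> = ennreal (real t powr \<beta>) * IY + (ennreal K * (ennreal (\<alpha> t) * IY)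
        + ennreal K * (ennreal (\<alpha> t) * IZ)
        + ennreal (K * c2) * ennreal (real t powr (\<beta> - p * q)))"
      using nn K by (simp add: ennreal_mult distrib_right mult.assoc) (simp add: ac_simps)
    \<comment> \<open>Only the drift is enlarged from \<open>A\<close> to the whole space; the
      leading term must stay on \<open>A\<close> to be the integral of \<open>W t\<close>
      there.\<close>
    also have "\<dots> \<le> ennreal (real t powr \<beta>) * IY + r t"
      unfolding r_def by (intro add_mono mult_left_mono IY IZ order_refl) auto
    also have "ennreal (real t powr \<beta>) * IY = (\<integral>\<^sup>+\<omega>\<in>A. W t \<omega> \<partial>M)"
      by (simp add: W_def IY_def nn_integral_cmult mult.assoc)
    finally show ?thesis .
  qed
  have sums: "(\<Sum>t. ennreal (\<alpha> (t + N)) * y (t + N)) < \<infinity>"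
    "(\<Sum>t. ennreal (\<alpha> (t + N)) * z (t + N)) < \<infinity>"
    using le_less_trans[OF suminf_ennreal_shift_le assms(17), of m]
      le_less_trans[OF suminf_ennreal_shift_le assms(18), of m]
    by (auto simp: N_def y_def z_def)
  \<comment> \<open>The strict inequality \<open>\<beta> < \<delta>\<close> puts the exponent below
    -1.\<close>
  have "summable (\<lambda>t. real t powr (\<beta> - p * q))"
    using \<beta> by (subst summable_real_powr_iff) (auto simp: \<delta>_def)
  then have "summable (\<lambda>t. real (t + N) powr (\<beta> - p * q))"
    by (subst summable_iff_shift)
  then have sum3: "(\<Sum>t. ennreal (real (t + N) powr (\<beta> - p * q))) < \<infinity>"
    using ennreal_suminf_neq_top by (auto simp: less_top)
  have r: "(\<Sum>t. r (t + N)) < \<infinity>"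
    unfolding r_def using sums sum3
    by (simp add: suminf_add[symmetric] ennreal_suminf_cmult ennreal_mult_less_top)
  \<comment> \<open>Integrability of the starting value is extracted from the series: one of its
    terms is finite and \<open>\<alpha> N\<close> is positive.\<close>
  have "ennreal (\<alpha> N) * y N < \<infinity>"
    using ennreal_suminf_lessD[OF sums(1), of 0] by simp
  then have "y N < \<infinity>"
    using \<alpha>[of N] by (auto simp: ennreal_mult_less_top)
  then have W0: "(\<integral>\<^sup>+\<omega>. W N \<omega> \<partial>M) < \<infinity>"
    by (simp add: W_def y_def nn_integral_cmult ennreal_mult_less_top)
  have filtN: "filtration (space M) (\<lambda>t. F (t + N))"
    using filt by (auto simp: filtration_def)
  have "AE \<omega> in M. \<exists>n::nat. \<forall>t. W (t + N) \<omega> < of_nat n"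
  proof (rule AE_bounded_almost_supermartingale[OF filtN sub])
    show "W (t + N) \<in> borel_measurable (F (t + N))" for t
      using YF[of "t + N"] unfolding W_def by measurable
    show "(\<integral>\<^sup>+\<omega>\<in>A. W (Suc t + N) \<omega> \<partial>M) \<le> (\<integral>\<^sup>+\<omega>\<in>A. W (t + N) \<omega> \<partial>M) + r (t + N)"
      if "A \<in> sets (F (t + N))" for t A
      using step[OF _ that] by simp
  qed (use W0 r in auto)
  then show "AE \<omega> in M. (\<lambda>t. real t powr (min (1 - p) (p * (1 + \<gamma>) - 1) - \<epsilon>) * Y t \<omega>) \<longlonglongrightarrow> 0"
  proof (rule AE_mp, intro AE_I2 impI)
    fix \<omega>
    assume \<omega>: "\<omega> \<in> space M" and "\<exists>n::nat. \<forall>t. W (t + N) \<omega> < of_nat n"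
    then obtain n :: nat where n: "W (t + N) \<omega> < of_nat n" for t by blast
    have bnd: "real t powr \<beta> * Y t \<omega> \<le> real n" if "N \<le> t" for t
    proof -
      have "ennreal (real t powr \<beta> * Y t \<omega>) < ennreal (real n)"
        using n[of "t - N"] that Ypos[OF \<omega>, of t]
        by (simp add: W_def ennreal_mult ennreal_of_nat_eq_real_of_nat)
      then show ?thesis
        by (metis ennreal_le_iff less_imp_le of_nat_0_le_iff)
    qed
    \<comment> \<open>The exponent is negative because \<beta> was chosen above
      \<open>\<delta> - \<epsilon>\<close>.\<close>
    have "(\<lambda>t. real t powr (\<delta> - \<epsilon> - \<beta>)) \<longlonglongrightarrow> 0"
      using \<beta> by (intro tendsto_neg_powr filterlim_real_sequentially) auto
    then have lim: "(\<lambda>t. real t powr (\<delta> - \<epsilon> - \<beta>) * real n) \<longlonglongrightarrow> 0"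
      by (rule tendsto_mult_left_zero)
    have "(\<lambda>t. real t powr (\<delta> - \<epsilon>) * Y t \<omega>) \<longlonglongrightarrow> 0"
    proof (rule tendsto_sandwich[OF _ _ tendsto_const lim])
      show "\<forall>\<^sub>F t in sequentially. 0 \<le> real t powr (\<delta> - \<epsilon>) * Y t \<omega>"
        using less_imp_le[OF Ypos[OF \<omega>]] by (intro always_eventually allI mult_nonneg_nonneg) auto
      show "\<forall>\<^sub>F t in sequentially. real t powr (\<delta> - \<epsilon>) * Y t \<omega> \<le> real t powr (\<delta> - \<epsilon> - \<beta>) * real n"
        using eventually_ge_at_top[of N]
      proof eventually_elim
        case (elim t)
        have "real t powr (\<delta> - \<epsilon>) * Y t \<omega>
            = real t powr (\<delta> - \<epsilon> - \<beta>) * (real t powr \<beta> * Y t \<omega>)"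
          by (simp add: mult.assoc[symmetric] powr_add[symmetric])
        also have "\<dots> \<le> real t powr (\<delta> - \<epsilon> - \<beta>) * real n"
          using bnd[OF elim] by (intro mult_left_mono) auto
        finally show ?case .
      qed
    qed
    then show "(\<lambda>t. real t powr (min (1 - p) (p * (1 + \<gamma>) - 1) - \<epsilon>) * Y t \<omega>) \<longlonglongrightarrow> 0"
      by (simp add: \<delta>_def q_def)
  qed
qed

end
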